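(* Let $(X,*_0,*_1)$ be a mutually distributive set, where $*_0$ has arity $k$ and $*_1$ has arity $k'$, and let $W$ be the $(k+k'-1)$-ary distributive operation $W(x,\mathbf{y}_0,\mathbf{y}_1)=(x*_0\mathbf{y}_0)*_1\mathbf{y}_1$. Let $A$ be an abelian group. Define homomorphisms $\mathcal{F}_{\sharp,n}: C_n^W(X)\to C_n^L(X)$ for $n=1,2,3$ on generators by $$\mathcal{F}_{\sharp,1}=\mathrm{id},\qquad \mathcal{F}_{\sharp,2}(x,\mathbf{y}_0,\mathbf{y}_1)=(x,\mathbf{y}_0)_0+(x*_0\mathbf{y}_0,\mathbf{y}_1)_1,$$ $$\mathcal{F}_{\sharp,3}(x,\mathbf{y}_0,\mathbf{y}_1,\mathbf{z}_0,\mathbf{z}_1)=(x,\mathbf{y}_0,\mathbf{z}_0)_{00}+(x*_0\mathbf{z}_0,\mathbf{y}_0*_0\mathbf{z}_0,\mathbf{z}_1)_{01}+(x*_0\mathbf{y}_0,\mathbf{y}_1,\mathbf{z}_0)_{10}+((x*_0\mathbf{y}_0)*_0\mathbf{z}_0,\mathbf{y}_1*_0\mathbf{z}_0,\mathbf{z}_1)_{11},$$ where $x \in X$, $\mathbf{y}_0,\mathbf{z}_0\in X^{k-1}$, $\mathbf{y}_1,\mathbf{z}_1\in X^{k'-1}$. Then for $n=2,3$ the maps $\mathcal{F}_{\sharp,n}$ are chain maps, i.e. $\partial_n\mathcal{F}_{\sharp,n}=\mathcal{F}_{\sharp,n-1}\partial^W_n$. Therefore, for $n=2,3$, they induce homomorphisms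 $\mathcal{F}_{*,n}:H_n^W(X,A)\to H_n^L(X,A)$ in homology and (by dualization) $\mathcal{F}^{*,n}:H^n_L(X,A)\to H^n_W(X,A)$ in cohomology.
   Context: Notation: for an $n$-ary operation $*$ on $X$ and $\mathbf{y}\in X^{n-1}$, $x*\mathbf{y}$ denotes the value at $(x,y_1,\dots,y_{n-1})$, and $\mathbf{x}*\mathbf{y}=(x_1*\mathbf{y},\dots,x_m*\mathbf{y})$ for $\mathbf{x}\in X^m$. The operation is distributive if $(x*\mathbf{y})*\mathbf{z}=(x*\mathbf{z})*(\mathbf{y}*\mathbf{z})$ always. A mutually distributive set $(X,*_0,*_1)$ is a set with two distributive operations such that $(x*_0\mathbf{y})*_1\mathbf{z}=(x*_1\mathbf{z})*_0(\mathbf{y}*_1\mathbf{z})$ and $(x*_1\mathbf{u})*_0\mathbf{v}=(x*_0\mathbf{v})*_1(\mathbf{u}*_0\mathbf{v})$ for all $x\in X$ and vectors of appropriate lengths. In that case $W$ is distributive. Labeled complex $C^L_\bullet(X)$: for $n\ge1$, $C^L_n(X)$ is the free abelian group on all tuples $(x_0,\mathbf{x}_1,\dots,\mathbf{x}_{n-1})_{\epsilon_1\cdots\epsilon_{n-1}}$, where $\epsilon_i\in\{0,1\}$, $x_0\in X$, and $\mathbf{x}_i\in X^{k-1}$ if $\epsilon_i=0$, $\mathbf{x}_i\in X^{k'-1}$ if $\epsilon_i=1$. The differential $\partial_n:C_n^L(X)\to C_{n-1}^L(X)$ is $$\partial_n(x_0,\mathbf{x}_1,\dots,\mathbf{x}_{n-1})_{\vec\epsilon}=\sum_{i=1}^{n-1}(-1)^i\bigl[(x_0*_{\epsilon_i}\mathbf{x}_i,\mathbf{x}_1*_{\epsilon_i}\mathbf{x}_i,\dots,\mathbf{x}_{i-1}*_{\epsilon_i}\mathbf{x}_i,\mathbf{x}_{i+1},\dots,\mathbf{x}_{n-1})_{\vec\epsilon^{\,i}}-(x_0,\mathbf{x}_1,\dots,\widehat{\mathbf{x}_i},\dots,\mathbf{x}_{n-1})_{\vec\epsilon^{\,i}}\bigr],$$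 with $\vec\epsilon^{\,i}$ obtained from $\vec\epsilon$ by deleting $\epsilon_i$. This is a chain complex. The complex $(C^W_\bullet(X),\partial^W)$ is the same construction for the single distributive operation $W$: $C_n^W(X)$ is free on tuples $(x_0,\mathbf{w}_1,\dots,\mathbf{w}_{n-1})$ with $x_0\in X$, $\mathbf{w}_i\in X^{k+k'-2}$, and $\partial^W_n$ is given by the same formula with every operation equal to $W$ (and no labels). Here $\mathbf{w}_i$ is written as a concatenation, e.g. $\mathbf{w}_1=(\mathbf{y}_0,\mathbf{y}_1)$ and $\mathbf{w}_2=(\mathbf{z}_0,\mathbf{z}_1)$. $H_n^L(X,A)$, $H_n^W(X,A)$ are the homology groups of $C_\bullet\otimes A$, and $H^n_L(X,A)$, $H^n_W(X,A)$ the cohomology groups of $\mathrm{Hom}(C_\bullet,A)$. *)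

theory Defs
  imports "HOL-Algebra.Generated_Groups" "HOL-Algebra.Free_Abelian_Groups"
begin

section \<open>Mutually distributive sets\<close>

text \<open>Vectors over \<open>X\<close> are lists. An \<open>n\<close>-ary operation takes its first argument
  separately and the remaining \<open>n - 1\<close> arguments as a list.\<close>

definition vectors :: "'a set \<Rightarrow> nat \<Rightarrow> 'a list set" where
  "vectors X m = {v. set v \<subseteq> X \<and> length v = m}"

definition vec_act :: "('a \<Rightarrow> 'a list \<Rightarrow> 'a) \<Rightarrow> 'a list \<Rightarrow> 'a list \<Rightarrow> 'a list" where
  "vec_act f v y = map (\<lambda>x. f x y) v"

definition nary_operation :: "'a set \<Rightarrow> nat \<Rightarrow> ('a \<Rightarrow> 'a list \<Rightarrow> 'a) \<Rightarrow> bool" where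
  "nary_operation X n f \<longleftrightarrow> 1 \<le> n \<and> (\<forall>x\<in>X. \<forall>y\<in>vectors X (n - 1). f x y \<in> X)"

definition distributive_op :: "'a set \<Rightarrow> nat \<Rightarrow> ('a \<Rightarrow> 'a list \<Rightarrow> 'a) \<Rightarrow> bool" where
  "distributive_op X n f \<longleftrightarrow> nary_operation X n f \<and>
     (\<forall>x\<in>X. \<forall>y\<in>vectors X (n - 1). \<forall>z\<in>vectors X (n - 1).
        f (f x y) z = f (f x z) (vec_act f y z))"

definition mutually_distributive ::
    "'a set \<Rightarrow> nat \<Rightarrow> ('a \<Rightarrow> 'a list \<Rightarrow> 'a) \<Rightarrow> nat \<Rightarrow> ('a \<Rightarrow> 'a list \<Rightarrow> 'a) \<Rightarrow> bool" where
  "mutually_distributive X k f k' g \<longleftrightarrow>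
     distributive_op X k f \<and> distributive_op X k' g \<and>
     (\<forall>x\<in>X. \<forall>y\<in>vectors X (k - 1). \<forall>z\<in>vectors X (k' - 1).
        g (f x y) z = f (g x z) (vec_act g y z)) \<and>
     (\<forall>x\<in>X. \<forall>u\<in>vectors X (k' - 1). \<forall>v\<in>vectors X (k - 1).
        f (g x u) v = g (f x v) (vec_act f u v))"

text \<open>The argument \<open>w\<close> of \<open>W\<close> is the concatenation of \<open>y\<^sub>0\<close> (length \<open>k - 1\<close>) and \<open>y\<^sub>1\<close>.\<close>

definition W_op :: "nat \<Rightarrow> ('a \<Rightarrow> 'a list \<Rightarrow> 'a) \<Rightarrow> ('a \<Rightarrow> 'a list \<Rightarrow> 'a) \<Rightarrow> 'a \<Rightarrow> 'a list \<Rightarrow> 'a" where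
  "W_op k f g x w = g (f x (take (k - 1) w)) (drop (k - 1) w)"

lemma W_op_append: "length y0 = k - 1 \<Longrightarrow> W_op k f g x (y0 @ y1) = g (f x y0) y1"
  by (simp add: W_op_def)

lemma distributive_W_op:
  assumes "mutually_distributive X k f k' g"
  shows "distributive_op X (k + k' - 1) (W_op k f g)"
proof -
  have k: "1 \<le> k" "1 \<le> k'"
    and fX: "\<And>x y. x \<in> X \<Longrightarrow> y \<in> vectors X (k - 1) \<Longrightarrow> f x y \<in> X"
    and gX: "\<And>x y. x \<in> X \<Longrightarrow> y \<in> vectors X (k' - 1) \<Longrightarrow> g x y \<in> X"
    and ff: "\<And>x y z. x \<in> X \<Longrightarrow> y \<in> vectors X (k - 1) \<Longrightarrow> z \<in> vectors X (k - 1) \<Longrightarrow>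
        f (f x y) z = f (f x z) (vec_act f y z)"
    and gg: "\<And>x y z. x \<in> X \<Longrightarrow> y \<in> vectors X (k' - 1) \<Longrightarrow> z \<in> vectors X (k' - 1) \<Longrightarrow>
        g (g x y) z = g (g x z) (vec_act g y z)"
    and gf: "\<And>x y z. x \<in> X \<Longrightarrow> y \<in> vectors X (k - 1) \<Longrightarrow> z \<in> vectors X (k' - 1) \<Longrightarrow>
        g (f x y) z = f (g x z) (vec_act g y z)"
    and fg: "\<And>x u v. x \<in> X \<Longrightarrow> u \<in> vectors X (k' - 1) \<Longrightarrow> v \<in> vectors X (k - 1) \<Longrightarrow>
        f (g x u) v = g (f x v) (vec_act f u v)"
    using assms by (auto simp: mutually_distributive_def distributive_op_def nary_operation_def)
  have split: "take (k - 1) w \<in> vectors X (k - 1)" "drop (k - 1) w \<in> vectors X (k' - 1)"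
    if "w \<in> vectors X (k + k' - 1 - 1)" for w
    using that k by (auto simp: vectors_def dest: in_set_takeD in_set_dropD)
  have actf: "vec_act f v z \<in> vectors X m"
    if "v \<in> vectors X m" "z \<in> vectors X (k - 1)" for v z m
    using that fX by (auto simp: vectors_def vec_act_def)
  have main: "W_op k f g (W_op k f g x y) z
      = W_op k f g (W_op k f g x z) (vec_act (W_op k f g) y z)"
    if x: "x \<in> X" and y: "y \<in> vectors X (k + k' - 1 - 1)"
      and z: "z \<in> vectors X (k + k' - 1 - 1)" for x y z
  proof -
    define y0 y1 z0 z1 where d:
      "y0 = take (k - 1) y" "y1 = drop (k - 1) y" "z0 = take (k - 1) z" "z1 = drop (k - 1) z"
    have m: "y0 \<in> vectors X (k - 1)" "y1 \<in> vectors X (k' - 1)"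
        "z0 \<in> vectors X (k - 1)" "z1 \<in> vectors X (k' - 1)"
      using split y z by (auto simp: d)
    have act: "vec_act (W_op k f g) v z = vec_act g (vec_act f v z0) z1" for v
      by (simp add: vec_act_def W_op_def d)
    have "take (k - 1) (vec_act g (vec_act f y z0) z1) = vec_act g (vec_act f y0 z0) z1"
         "drop (k - 1) (vec_act g (vec_act f y z0) z1) = vec_act g (vec_act f y1 z0) z1"
      by (simp_all add: vec_act_def d take_map drop_map)
    then have "W_op k f g (W_op k f g x z) (vec_act (W_op k f g) y z) =
        g (f (g (f x z0) z1) (vec_act g (vec_act f y0 z0) z1)) (vec_act g (vec_act f y1 z0) z1)"
      by (simp add: act) (simp add: W_op_def d)
    also have "\<dots> = g (g (f (f x y0) z0) z1) (vec_act g (vec_act f y1 z0) z1)"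
      using gf[of "f x z0" "vec_act f y0 z0" z1] ff[of x y0 z0] x m by (simp add: fX actf)
    also have "\<dots> = g (f (g (f x y0) y1) z0) z1"
      using gg[of "f (f x y0) z0" "vec_act f y1 z0" z1] fg[of "f x y0" y1 z0] x m by (simp add: fX actf)
    also have "\<dots> = W_op k f g (W_op k f g x y) z"
      by (simp add: W_op_def d)
    finally show ?thesis by simp
  qed
  have "nary_operation X (k + k' - 1) (W_op k f g)"
    using k split by (auto simp: nary_operation_def W_op_def intro!: gX fX)
  with main show ?thesis
    by (simp add: distributive_op_def)
qed


section \<open>The chain complexes\<close>

text \<open>The tuple \<open>(x\<^sub>0, x\<^sub>1, \<dots>, x\<^sub>m)\<close> with labels \<open>\<epsilon>\<^sub>1 \<dots> \<epsilon>\<^sub>m\<close> is the pair of \<open>x\<^sub>0\<close> and the list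
  \<open>[(\<epsilon>\<^sub>1, x\<^sub>1), \<dots>, (\<epsilon>\<^sub>m, x\<^sub>m)]\<close>. The construction is carried out once, for a family \<open>opr\<close> of
  operations indexed by a set \<open>E\<close> of labels, with arities \<open>ar\<close>; the labels are \<open>0, 1\<close> in the
  labeled complex and \<open>()\<close> (that is, no information) in the complex of \<open>W\<close>.\<close>

type_synonym ('a, 'e) tuple = "'a \<times> ('e \<times> 'a list) list"

definition tuples_of_degree ::
    "'a set \<Rightarrow> 'e set \<Rightarrow> ('e \<Rightarrow> nat) \<Rightarrow> nat \<Rightarrow> ('a, 'e) tuple set" where
  "tuples_of_degree X E ar n = {(x, vs). x \<in> X \<and> length vs + 1 = n \<and>
     (\<forall>(e, v) \<in> set vs. e \<in> E \<and> v \<in> vectors X (ar e - 1))}"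

text \<open>In degree 0 there are no tuples, so this is the trivial group.\<close>

definition chain_group ::
    "'a set \<Rightarrow> 'e set \<Rightarrow> ('e \<Rightarrow> nat) \<Rightarrow> nat \<Rightarrow> (('a, 'e) tuple \<Rightarrow>\<^sub>0 int) monoid" where
  "chain_group X E ar n = free_Abelian_group (tuples_of_degree X E ar n)"

text \<open>List positions start at 0, so the \<open>i\<close>-th vector is \<open>vs ! (i - 1)\<close>.\<close>

definition boundary_gen ::
    "('e \<Rightarrow> 'a \<Rightarrow> 'a list \<Rightarrow> 'a) \<Rightarrow> ('a, 'e) tuple \<Rightarrow> (('a, 'e) tuple \<Rightarrow>\<^sub>0 int)" where
  "boundary_gen opr = (\<lambda>(x, vs). \<Sum>i = 1..length vs.
     (case vs ! (i - 1) of (e, v) \<Rightarrow>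
       frag_cmul ((- 1) ^ i)
         (frag_of (opr e x v,
                   map (\<lambda>(e', u). (e', vec_act (opr e) u v)) (take (i - 1) vs) @ drop i vs)
          - frag_of (x, take (i - 1) vs @ drop i vs))))"

definition boundary_map ::
    "('e \<Rightarrow> 'a \<Rightarrow> 'a list \<Rightarrow> 'a) \<Rightarrow> (('a, 'e) tuple \<Rightarrow>\<^sub>0 int) \<Rightarrow> (('a, 'e) tuple \<Rightarrow>\<^sub>0 int)" where
  "boundary_map opr = frag_extend (boundary_gen opr)"

definition C_L :: "'a set \<Rightarrow> nat \<Rightarrow> nat \<Rightarrow> nat \<Rightarrow> (('a, nat) tuple \<Rightarrow>\<^sub>0 int) monoid" where
  "C_L X k k' = chain_group X {0, 1} (\<lambda>e. if e = 0 then k else k')"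

definition d_L :: "('a \<Rightarrow> 'a list \<Rightarrow> 'a) \<Rightarrow> ('a \<Rightarrow> 'a list \<Rightarrow> 'a) \<Rightarrow>
    (('a, nat) tuple \<Rightarrow>\<^sub>0 int) \<Rightarrow> (('a, nat) tuple \<Rightarrow>\<^sub>0 int)" where
  "d_L f g = boundary_map (\<lambda>e. if e = 0 then f else g)"

definition C_W :: "'a set \<Rightarrow> nat \<Rightarrow> nat \<Rightarrow> nat \<Rightarrow> (('a, unit) tuple \<Rightarrow>\<^sub>0 int) monoid" where
  "C_W X k k' = chain_group X UNIV (\<lambda>_. k + k' - 1)"

definition d_W :: "nat \<Rightarrow> ('a \<Rightarrow> 'a list \<Rightarrow> 'a) \<Rightarrow> ('a \<Rightarrow> 'a list \<Rightarrow> 'a) \<Rightarrow>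
    (('a, unit) tuple \<Rightarrow>\<^sub>0 int) \<Rightarrow> (('a, unit) tuple \<Rightarrow>\<^sub>0 int)" where
  "d_W k f g = boundary_map (\<lambda>_. W_op k f g)"


section \<open>The maps from the complex of \<open>W\<close> to the labeled complex\<close>

text \<open>Only the degrees 1, 2, 3 matter; the value 0 on longer tuples is a dummy.\<close>

fun F_gen :: "nat \<Rightarrow> ('a \<Rightarrow> 'a list \<Rightarrow> 'a) \<Rightarrow> ('a, unit) tuple \<Rightarrow> (('a, nat) tuple \<Rightarrow>\<^sub>0 int)" where
  "F_gen k f (x, []) = frag_of (x, [])"
| "F_gen k f (x, [(_, y)]) =
     (let y0 = take (k - 1) y; y1 = drop (k - 1) y in
        frag_of (x, [(0, y0)]) + frag_of (f x y0, [(1, y1)]))"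
| "F_gen k f (x, [(_, y), (_, z)]) =
     (let y0 = take (k - 1) y; y1 = drop (k - 1) y;
          z0 = take (k - 1) z; z1 = drop (k - 1) z in
        frag_of (x, [(0, y0), (0, z0)])
      + frag_of (f x z0, [(0, vec_act f y0 z0), (1, z1)])
      + frag_of (f x y0, [(1, y1), (0, z0)])
      + frag_of (f (f x y0) z0, [(1, vec_act f y1 z0), (1, z1)]))"
| "F_gen k f (x, _ # _ # _ # _) = 0"

definition F_sharp :: "nat \<Rightarrow> ('a \<Rightarrow> 'a list \<Rightarrow> 'a) \<Rightarrow>
    (('a, unit) tuple \<Rightarrow>\<^sub>0 int) \<Rightarrow> (('a, nat) tuple \<Rightarrow>\<^sub>0 int)" where
  "F_sharp k f = frag_extend (F_gen k f)"


section \<open>Homology of complexes of abelian groups\<close>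

text \<open>The differential \<open>d n\<close> goes from \<open>C n\<close> to \<open>C (n - 1)\<close>.\<close>

definition cycles :: "(nat \<Rightarrow> ('c, 'm) monoid_scheme) \<Rightarrow> (nat \<Rightarrow> 'c \<Rightarrow> 'c) \<Rightarrow> nat \<Rightarrow> 'c set" where
  "cycles C d n = kernel (C n) (C (n - 1)) (d n)"

definition boundaries :: "(nat \<Rightarrow> ('c, 'm) monoid_scheme) \<Rightarrow> (nat \<Rightarrow> 'c \<Rightarrow> 'c) \<Rightarrow> nat \<Rightarrow> 'c set" where
  "boundaries C d n = d (n + 1) ` carrier (C (n + 1))"

definition homology ::
    "(nat \<Rightarrow> ('c, 'm) monoid_scheme) \<Rightarrow> (nat \<Rightarrow> 'c \<Rightarrow> 'c) \<Rightarrow> nat \<Rightarrow> 'c set monoid" where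
  "homology C d n = (C n)\<lparr>carrier := cycles C d n\<rparr> Mod boundaries C d n"

definition homology_class ::
    "(nat \<Rightarrow> ('c, 'm) monoid_scheme) \<Rightarrow> (nat \<Rightarrow> 'c \<Rightarrow> 'c) \<Rightarrow> nat \<Rightarrow> 'c \<Rightarrow> 'c set" where
  "homology_class C d n z = boundaries C d n #>\<^bsub>C n\<^esub> z"

text \<open>For cochain complexes, \<open>d n\<close> goes from \<open>C n\<close> to \<open>C (n + 1)\<close>; the cohomology in degree \<open>n\<close>
  is only used for \<open>n \<ge> 1\<close>.\<close>

definition cocycles :: "(nat \<Rightarrow> ('c, 'm) monoid_scheme) \<Rightarrow> (nat \<Rightarrow> 'c \<Rightarrow> 'c) \<Rightarrow> nat \<Rightarrow> 'c set" where
  "cocycles C d n = kernel (C n) (C (n + 1)) (d n)"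

definition coboundaries ::
    "(nat \<Rightarrow> ('c, 'm) monoid_scheme) \<Rightarrow> (nat \<Rightarrow> 'c \<Rightarrow> 'c) \<Rightarrow> nat \<Rightarrow> 'c set" where
  "coboundaries C d n = d (n - 1) ` carrier (C (n - 1))"

definition cohomology ::
    "(nat \<Rightarrow> ('c, 'm) monoid_scheme) \<Rightarrow> (nat \<Rightarrow> 'c \<Rightarrow> 'c) \<Rightarrow> nat \<Rightarrow> 'c set monoid" where
  "cohomology C d n = (C n)\<lparr>carrier := cocycles C d n\<rparr> Mod coboundaries C d n"

definition cohomology_class ::
    "(nat \<Rightarrow> ('c, 'm) monoid_scheme) \<Rightarrow> (nat \<Rightarrow> 'c \<Rightarrow> 'c) \<Rightarrow> nat \<Rightarrow> 'c \<Rightarrow> 'c set" where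
  "cohomology_class C d n z = coboundaries C d n #>\<^bsub>C n\<^esub> z"


section \<open>Coefficients\<close>

text \<open>The tensor product of two abelian groups, as the free abelian group on all pairs modulo
  bilinearity. Group operations are written multiplicatively, as everywhere in the library,
  except in free abelian groups, where the operation is addition of finitely supported functions.\<close>

definition pairs_group ::
    "('c, 'm) monoid_scheme \<Rightarrow> ('b, 'n) monoid_scheme \<Rightarrow> ('c \<times> 'b \<Rightarrow>\<^sub>0 int) monoid" where
  "pairs_group C A = free_Abelian_group (carrier C \<times> carrier A)"

definition bilinear_relations ::
    "('c, 'm) monoid_scheme \<Rightarrow> ('b, 'n) monoid_scheme \<Rightarrow> ('c \<times> 'b \<Rightarrow>\<^sub>0 int) set" where
  "bilinear_relations C A =
     {frag_of (c \<otimes>\<^bsub>C\<^esub> c', a) - frag_of (c, a) - frag_of (c', a) | c c' a.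
        c \<in> carrier C \<and> c' \<in> carrier C \<and> a \<in> carrier A} \<union>
     {frag_of (c, a \<otimes>\<^bsub>A\<^esub> a') - frag_of (c, a) - frag_of (c, a') | c a a'.
        c \<in> carrier C \<and> a \<in> carrier A \<and> a' \<in> carrier A}"

definition bilinear_subgroup ::
    "('c, 'm) monoid_scheme \<Rightarrow> ('b, 'n) monoid_scheme \<Rightarrow> ('c \<times> 'b \<Rightarrow>\<^sub>0 int) set" where
  "bilinear_subgroup C A = generate (pairs_group C A) (bilinear_relations C A)"

definition tensor ::
    "('c, 'm) monoid_scheme \<Rightarrow> ('b, 'n) monoid_scheme \<Rightarrow> ('c \<times> 'b \<Rightarrow>\<^sub>0 int) set monoid" where
  "tensor C A = pairs_group C A Mod bilinear_subgroup C A"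

text \<open>The map \<open>h \<otimes> id\<close> into \<open>D \<otimes> A\<close>: for a coset \<open>T\<close>, the image of a representative \<open>t\<close> under
  \<open>(c, a) \<mapsto> (h c, a)\<close> determines a coset that does not depend on \<open>t\<close> when \<open>h\<close> is a
  homomorphism into \<open>D\<close>.\<close>

definition tensor_map ::
    "('d, 'm) monoid_scheme \<Rightarrow> ('b, 'n) monoid_scheme \<Rightarrow> ('c \<Rightarrow> 'd) \<Rightarrow>
     ('c \<times> 'b \<Rightarrow>\<^sub>0 int) set \<Rightarrow> ('d \<times> 'b \<Rightarrow>\<^sub>0 int) set" where
  "tensor_map D A h T = the_elem
     ((\<lambda>t. bilinear_subgroup D A #>\<^bsub>pairs_group D A\<^esub>
             frag_extend (\<lambda>(c, a). frag_of (h c, a)) t) ` T)"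

text \<open>Homomorphisms are taken extensional, since otherwise their values outside the carrier of \<open>C\<close>
  would distinguish them.\<close>

definition Hom_group ::
    "('c, 'm) monoid_scheme \<Rightarrow> ('b, 'n) monoid_scheme \<Rightarrow> ('c \<Rightarrow> 'b) monoid" where
  "Hom_group C A =
     \<lparr>carrier = hom C A \<inter> extensional (carrier C),
      mult = (\<lambda>\<phi> \<psi>. \<lambda>c\<in>carrier C. \<phi> c \<otimes>\<^bsub>A\<^esub> \<psi> c),
      one = (\<lambda>c\<in>carrier C. \<one>\<^bsub>A\<^esub>)\<rparr>"

text \<open>The dual \<open>\<phi> \<mapsto> \<phi> \<circ> h\<close> of a map \<open>h\<close> defined on \<open>C\<close>.\<close>

definition dual_map :: "('c, 'm) monoid_scheme \<Rightarrow> ('c \<Rightarrow> 'd) \<Rightarrow> ('d \<Rightarrow> 'b) \<Rightarrow> ('c \<Rightarrow> 'b)" where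
  "dual_map C h \<phi> = compose (carrier C) \<phi> h"

definition tensor_complex ::
    "(nat \<Rightarrow> ('c, 'm) monoid_scheme) \<Rightarrow> ('b, 'n) monoid_scheme \<Rightarrow>
     nat \<Rightarrow> ('c \<times> 'b \<Rightarrow>\<^sub>0 int) set monoid" where
  "tensor_complex C A n = tensor (C n) A"

definition tensor_differential ::
    "(nat \<Rightarrow> ('c, 'm) monoid_scheme) \<Rightarrow> ('c \<Rightarrow> 'c) \<Rightarrow> ('b, 'n) monoid_scheme \<Rightarrow>
     nat \<Rightarrow> ('c \<times> 'b \<Rightarrow>\<^sub>0 int) set \<Rightarrow> ('c \<times> 'b \<Rightarrow>\<^sub>0 int) set" where
  "tensor_differential C d A n = tensor_map (C (n - 1)) A d"

definition Hom_complex ::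
    "(nat \<Rightarrow> ('c, 'm) monoid_scheme) \<Rightarrow> ('b, 'n) monoid_scheme \<Rightarrow> nat \<Rightarrow> ('c \<Rightarrow> 'b) monoid" where
  "Hom_complex C A n = Hom_group (C n) A"

definition Hom_differential ::
    "(nat \<Rightarrow> ('c, 'm) monoid_scheme) \<Rightarrow> ('c \<Rightarrow> 'c) \<Rightarrow> nat \<Rightarrow> ('c \<Rightarrow> 'b) \<Rightarrow> ('c \<Rightarrow> 'b)" where
  "Hom_differential C d n = dual_map (C (n + 1)) d"

end

theory Submission
  imports Defs
begin

text \<open>The formulas for \<open>F\<close> in degrees 1, 2, 3 are the beginning of a recursion: for a tuple \<open>t\<close> and a
  vector \<open>w = (w\<^sub>0, w\<^sub>1)\<close>, \<open>F (t, w) = (F t, w\<^sub>0)\<^sub>0 + (F t *\<^sub>0 w\<^sub>0, w\<^sub>1)\<^sub>1\<close>, where a vector acts on all entries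
  of a tuple. This extends \<open>F\<close> to all degrees; degree 4 is needed because its chains bound in degree 3.
  For a chain \<open>c\<close> of degree \<open>n\<close>, \<open>\<partial> (c, v)\<^sub>e = (\<partial> c, v)\<^sub>e + (-1)\<^sup>n (c *\<^sub>e v - c)\<close>. By distributivity, \<open>\<partial>\<close>
  commutes with the action of a vector, and \<open>F\<close> turns the action of \<open>w\<close> through \<open>W\<close> into that of \<open>w\<^sub>0\<close>
  followed by that of \<open>w\<^sub>1\<close>. In \<open>\<partial> F (t, w)\<close> the two terms \<open>F t *\<^sub>0 w\<^sub>0\<close> cancel, which leaves
  \<open>F (\<partial> (t, w))\<close> by induction on the length of the tuple.\<close>


section \<open>Free abelian groups\<close>

lemma frag_extend_extend:
  "frag_extend f (frag_extend g c) = frag_extend (\<lambda>x. frag_extend f (g x)) c"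
  using subset_UNIV
  by (induction c rule: frag_induction) (auto simp: frag_extend_diff)

text \<open>The free abelian group on \<open>S\<close> consists of the chains supported in
  \<open>S\<close>, so the degree of a chain is tracked through its \<open>keys\<close>.\<close>

lemma keys_frag_extend_subset:
  assumes "\<And>s. s \<in> S \<Longrightarrow> Poly_Mapping.keys (h s) \<subseteq> T" and "Poly_Mapping.keys c \<subseteq> S"
  shows "Poly_Mapping.keys (frag_extend h c) \<subseteq> T"
  using keys_frag_extend[of h c] assms by fastforce

lemma keys_add_subset:
  "Poly_Mapping.keys a \<subseteq> S \<Longrightarrow> Poly_Mapping.keys b \<subseteq> S \<Longrightarrow> Poly_Mapping.keys (a + b) \<subseteq> S"
  using keys_add[of a b] by blast

lemma frag_extend_hom:
  assumes "\<And>s. s \<in> S \<Longrightarrow> h s \<in> carrier (free_Abelian_group T)"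
  shows "frag_extend h \<in> hom (free_Abelian_group S) (free_Abelian_group T)"
proof (rule homI)
  fix c
  assume "c \<in> carrier (free_Abelian_group S)"
  then show "frag_extend h c \<in> carrier (free_Abelian_group T)"
    using keys_frag_extend_subset[of S h T c] assms by simp
qed (simp add: frag_extend_add)

lemma frag_cmul_diff_right: "frag_cmul k (a - b) = frag_cmul k a - frag_cmul k b"
  by (rule poly_mapping_eqI) (simp add: lookup_minus right_diff_distrib)

abbreviation frag_map :: "('s \<Rightarrow> 't) \<Rightarrow> ('s \<Rightarrow>\<^sub>0 int) \<Rightarrow> ('t \<Rightarrow>\<^sub>0 int)" where
  "frag_map h \<equiv> frag_extend (\<lambda>s. frag_of (h s))"

lemma keys_frag_map_subset:
  assumes "h \<in> S \<rightarrow> T" and "Poly_Mapping.keys c \<subseteq> S"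
  shows "Poly_Mapping.keys (frag_map h c) \<subseteq> T"
  by (rule keys_frag_extend_subset[OF _ assms(2)]) (use assms(1) in auto)


section \<open>The boundary of a tuple extended by one vector\<close>

text \<open>A face of the boundary treats the entries in front of the removed vector in this way;
  labels stay fixed.\<close>

definition tuple_act :: "('a \<Rightarrow> 'a list \<Rightarrow> 'a) \<Rightarrow> 'a list \<Rightarrow> ('a, 'e) tuple \<Rightarrow> ('a, 'e) tuple" where
  "tuple_act p v = (\<lambda>(x, vs). (p x v, map (\<lambda>(e, u). (e, vec_act p u v)) vs))"

text \<open>Tuples grow at the right end because a face acts only to the left of the vector it
  removes: an appended vector is left alone by all faces except its own.\<close>

definition tuple_snoc :: "'e \<Rightarrow> 'a list \<Rightarrow> ('a, 'e) tuple \<Rightarrow> ('a, 'e) tuple" where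
  "tuple_snoc e v = (\<lambda>(x, vs). (x, vs @ [(e, v)]))"

lemma tuple_act_snoc:
  "tuple_act p v (tuple_snoc e u t) = tuple_snoc e (vec_act p u v) (tuple_act p v t)"
  by (simp add: tuple_act_def tuple_snoc_def split: prod.split)

lemma tuple_snoc_induct [case_names singleton snoc]:
  assumes "\<And>x. P (x, [])" and "\<And>t e v. P t \<Longrightarrow> P (tuple_snoc e v t)"
  shows "P t"
proof (cases t)
  case (Pair x vs)
  have "P (x, vs)"
  proof (induction vs rule: rev_induct)
    case (snoc p vs)
    with assms(2)[of "(x, vs)" "fst p" "snd p"] show ?case by (simp add: tuple_snoc_def)
  qed (rule assms(1))
  with Pair show ?thesis by simp
qed

lemma tuple_snoc_in_degree_iff:
  "tuple_snoc e v t \<in> tuples_of_degree X E ar (Suc n) \<longleftrightarrow>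
     t \<in> tuples_of_degree X E ar n \<and> e \<in> E \<and> v \<in> vectors X (ar e - 1)"
  by (auto simp: tuples_of_degree_def tuple_snoc_def split: prod.splits)

lemma tuple_snoc_not_degree_0: "tuple_snoc e v t \<notin> tuples_of_degree X E ar 0"
  by (auto simp: tuples_of_degree_def)

lemma boundary_gen_singleton [simp]: "boundary_gen opr (x, []) = 0"
  by (simp add: boundary_gen_def)

text \<open>Faces that remove a vector of \<open>t\<close> keep \<open>v\<close> as last entry,
  which gives the first summand. The last pair of faces removes \<open>v\<close>, and one of the two
  acts with \<open>v\<close> on all of \<open>t\<close>.\<close>

lemma boundary_gen_snoc:
  "boundary_gen opr (tuple_snoc e v t) =
     frag_map (tuple_snoc e v) (boundary_gen opr t)
     + frag_cmul ((- 1) ^ Suc (length (snd t))) (frag_of (tuple_act (opr e) v t) - frag_of t)"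
proof (cases t)
  case (Pair x vs)
  have "boundary_gen opr (x, vs @ [(e, v)]) = (\<Sum>i = 1..length vs.
     (case vs ! (i - 1) of (e', u) \<Rightarrow>
       frag_cmul ((- 1) ^ i)
         (frag_of (opr e' x u,
             map (\<lambda>(e'', w). (e'', vec_act (opr e') w u)) (take (i - 1) vs) @ drop i vs @ [(e, v)])
          - frag_of (x, take (i - 1) vs @ drop i vs @ [(e, v)]))))
     + frag_cmul ((- 1) ^ Suc (length vs))
         (frag_of (opr e x v, map (\<lambda>(e'', w). (e'', vec_act (opr e) w v)) vs) - frag_of (x, vs))"
    by (auto simp: boundary_gen_def nth_append intro!: sum.cong)
  also have "(\<Sum>i = 1..length vs.
     (case vs ! (i - 1) of (e', u) \<Rightarrow>
       frag_cmul ((- 1) ^ i)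
         (frag_of (opr e' x u,
             map (\<lambda>(e'', w). (e'', vec_act (opr e') w u)) (take (i - 1) vs) @ drop i vs @ [(e, v)])
          - frag_of (x, take (i - 1) vs @ drop i vs @ [(e, v)]))))
     = frag_map (tuple_snoc e v) (boundary_gen opr (x, vs))"
    by (auto simp: boundary_gen_def frag_extend_sum frag_extend_cmul frag_extend_diff tuple_snoc_def
        split: prod.split intro!: sum.cong)
  finally show ?thesis
    by (simp add: Pair tuple_act_def tuple_snoc_def)
qed

lemma boundary_map_snoc:
  assumes "Poly_Mapping.keys c \<subseteq> tuples_of_degree X E ar n"
  shows "boundary_map opr (frag_map (tuple_snoc e v) c) =
     frag_map (tuple_snoc e v) (boundary_map opr c)
     + frag_cmul ((- 1) ^ n) (frag_map (tuple_act (opr e) v) c - c)"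
  using assms
proof (induction c rule: frag_induction)
  case (one t)
  \<comment> \<open>The degree counts x_0 as well, so all tuples in \<open>c\<close> contribute the
    same sign.\<close>
  then have "Suc (length (snd t)) = n"
    by (auto simp: tuples_of_degree_def)
  then show ?case
    by (auto simp: boundary_map_def boundary_gen_snoc)
next
  case (diff a b)
  then show ?case
    by (simp add: boundary_map_def frag_extend_diff frag_cmul_diff_right)
qed (simp add: boundary_map_def)


section \<open>Families of mutually distributive operations\<close>

text \<open>A single law covers all cases: distributivity of one operation for
  \<open>e = e'\<close>, mutual distributivity for distinct labels. Both complexes are thus
  instances of one setting.\<close>

locale distributive_family =
  fixes X :: "'a set" and E :: "'e set" and ar :: "'e \<Rightarrow> nat" and opr :: "'e \<Rightarrow> 'a \<Rightarrow> 'a list \<Rightarrow> 'a"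
  assumes opr_closed: "e \<in> E \<Longrightarrow> x \<in> X \<Longrightarrow> v \<in> vectors X (ar e - 1) \<Longrightarrow> opr e x v \<in> X"
    and opr_distrib: "e \<in> E \<Longrightarrow> e' \<in> E \<Longrightarrow> x \<in> X \<Longrightarrow> u \<in> vectors X (ar e' - 1) \<Longrightarrow>
      v \<in> vectors X (ar e - 1) \<Longrightarrow> opr e (opr e' x u) v = opr e' (opr e x v) (vec_act (opr e) u v)"
begin

abbreviation "tuples \<equiv> tuples_of_degree X E ar"

section \<open>Actions of vectors on tuples and chains\<close>

lemma vec_act_closed:
  "e \<in> E \<Longrightarrow> v \<in> vectors X (ar e - 1) \<Longrightarrow> u \<in> vectors X m \<Longrightarrow> vec_act (opr e) u v \<in> vectors X m"
  using opr_closed by (auto simp: vectors_def vec_act_def)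

lemma vec_act_distrib:
  "e \<in> E \<Longrightarrow> e' \<in> E \<Longrightarrow> w \<in> vectors X m \<Longrightarrow> u \<in> vectors X (ar e' - 1) \<Longrightarrow> v \<in> vectors X (ar e - 1) \<Longrightarrow>
     vec_act (opr e) (vec_act (opr e') w u) v =
     vec_act (opr e') (vec_act (opr e) w v) (vec_act (opr e) u v)"
  using opr_distrib by (auto simp: vectors_def vec_act_def)

lemma tuple_act_closed:
  "e \<in> E \<Longrightarrow> v \<in> vectors X (ar e - 1) \<Longrightarrow> t \<in> tuples n \<Longrightarrow> tuple_act (opr e) v t \<in> tuples n"
  using opr_closed vec_act_closed by (fastforce simp: tuples_of_degree_def tuple_act_def)

text \<open>The distributive law holds in each entry separately: for x_0 by assumption, for the
  vectors by \<open>vec_act_distrib\<close>.\<close>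

lemma tuple_act_act:
  assumes "e \<in> E" "e' \<in> E" "u \<in> vectors X (ar e' - 1)" "v \<in> vectors X (ar e - 1)" "t \<in> tuples n"
  shows "tuple_act (opr e) v (tuple_act (opr e') u t) =
    tuple_act (opr e') (vec_act (opr e) u v) (tuple_act (opr e) v t)"
proof (cases t)
  case (Pair x vs)
  with assms(5) have x: "x \<in> X" and "\<And>d w. (d, w) \<in> set vs \<Longrightarrow> w \<in> vectors X (ar d - 1)"
    by (auto simp: tuples_of_degree_def)
  then have "map (\<lambda>(d, w). (d, vec_act (opr e) (vec_act (opr e') w u) v)) vs =
      map (\<lambda>(d, w). (d, vec_act (opr e') (vec_act (opr e) w v) (vec_act (opr e) u v))) vs"
    using vec_act_distrib[OF assms(1,2) _ assms(3,4)] by (intro map_cong) auto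
  then show ?thesis
    using opr_distrib[OF assms(1,2) x assms(3,4)] by (simp add: Pair tuple_act_def case_prod_unfold)
qed

lemma keys_frag_map_act:
  "e \<in> E \<Longrightarrow> v \<in> vectors X (ar e - 1) \<Longrightarrow> Poly_Mapping.keys c \<subseteq> tuples n \<Longrightarrow>
     Poly_Mapping.keys (frag_map (tuple_act (opr e) v) c) \<subseteq> tuples n"
  using tuple_act_closed by (intro keys_frag_map_subset) auto

lemma keys_frag_map_snoc:
  "e \<in> E \<Longrightarrow> v \<in> vectors X (ar e - 1) \<Longrightarrow> Poly_Mapping.keys c \<subseteq> tuples n \<Longrightarrow>
     Poly_Mapping.keys (frag_map (tuple_snoc e v) c) \<subseteq> tuples (Suc n)"
  by (intro keys_frag_map_subset) (auto simp: tuple_snoc_in_degree_iff)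

lemma frag_map_act_act:
  assumes "e \<in> E" "e' \<in> E" "u \<in> vectors X (ar e' - 1)" "v \<in> vectors X (ar e - 1)"
    and "Poly_Mapping.keys c \<subseteq> tuples n"
  shows "frag_map (tuple_act (opr e) v) (frag_map (tuple_act (opr e') u) c) =
    frag_map (tuple_act (opr e') (vec_act (opr e) u v)) (frag_map (tuple_act (opr e) v) c)"
  using assms tuple_act_act[OF assms(1-4)] by (auto simp: frag_extend_extend intro!: frag_extend_eq)

section \<open>The boundary and its compatibility with the actions\<close>

lemma keys_boundary_gen:
  "t \<in> tuples n \<Longrightarrow> Poly_Mapping.keys (boundary_gen opr t) \<subseteq> tuples (n - 1)"
proof (induction t arbitrary: n rule: tuple_snoc_induct)
  case (snoc t e v)
  then obtain m where n: "n = Suc m"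
    by (cases n) (auto simp: tuple_snoc_not_degree_0)
  with snoc.prems have t: "t \<in> tuples m" "e \<in> E" "v \<in> vectors X (ar e - 1)"
    by (auto simp: tuple_snoc_in_degree_iff)
  \<comment> \<open>A tuple has degree at least 1, so appending a vector to a chain of degree
    \<open>m - 1\<close> really gives degree \<open>m\<close>.\<close>
  then obtain l where m: "m = Suc l"
    by (cases m) (auto simp: tuples_of_degree_def)
  have "Poly_Mapping.keys (frag_of (tuple_act (opr e) v t) - frag_of t) \<subseteq> tuples m"
    by (rule order_trans[OF keys_diff]) (simp add: t(1) tuple_act_closed[OF t(2,3,1)])
  moreover have "Poly_Mapping.keys (frag_map (tuple_snoc e v) (boundary_gen opr t)) \<subseteq> tuples m"
    using keys_frag_map_snoc[OF t(2,3) snoc.IH[OF t(1)]] m by simp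
  ultimately show ?case
    unfolding boundary_gen_snoc n diff_Suc_1 using keys_cmul by (intro keys_add_subset) blast+
qed simp

lemma boundary_map_hom:
  "boundary_map opr \<in> hom (chain_group X E ar n) (chain_group X E ar (n - 1))"
  unfolding boundary_map_def chain_group_def 
  by (rule frag_extend_hom) (use keys_boundary_gen in simp)

text \<open>By induction through \<open>boundary_gen_snoc\<close>. The only term that needs an
  argument is \<open>t\<close> acted on by \<open>u\<close> and then by \<open>v\<close>:
  distributivity moves \<open>v\<close> inside and turns \<open>u\<close> into
  \<open>vec_act (opr e) u v\<close>, which is the vector that the acted tuple ends with.\<close>

lemma boundary_gen_act:
  assumes "e \<in> E" "v \<in> vectors X (ar e - 1)"
  shows "t \<in> tuples n \<Longrightarrow>
    boundary_gen opr (tuple_act (opr e) v t) = frag_map (tuple_act (opr e) v) (boundary_gen opr t)"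
proof (induction t arbitrary: n rule: tuple_snoc_induct)
  case (singleton x)
  then show ?case by (simp add: tuple_act_def)
next
  case (snoc t e' u)
  then obtain m where n: "n = Suc m"
    by (cases n) (auto simp: tuple_snoc_not_degree_0)
  with snoc.prems have t: "t \<in> tuples m" "e' \<in> E" "u \<in> vectors X (ar e' - 1)"
    by (auto simp: tuple_snoc_in_degree_iff)
  have "length (snd (tuple_act (opr e) v t)) = length (snd t)"
    by (simp add: tuple_act_def split: prod.split)
  then show ?case
    by (simp add: tuple_act_snoc boundary_gen_snoc snoc.IH[OF t(1)] frag_extend_add frag_extend_cmul
        frag_extend_diff frag_extend_extend tuple_act_act[OF assms(1) t(2,3) assms(2) t(1)])
qed

lemma boundary_map_act:
  assumes "e \<in> E" "v \<in> vectors X (ar e - 1)" "Poly_Mapping.keys c \<subseteq> tuples n"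
  shows "boundary_map opr (frag_map (tuple_act (opr e) v) c) =
    frag_map (tuple_act (opr e) v) (boundary_map opr c)"
  using assms boundary_gen_act[OF assms(1,2)]
  by (auto simp: boundary_map_def frag_extend_extend intro!: frag_extend_eq)

end


section \<open>The chain map in all degrees\<close>

text \<open>The recursive step is defined on chains, since the image of a single tuple is already a
  sum.\<close>

definition F_step :: "nat \<Rightarrow> ('a \<Rightarrow> 'a list \<Rightarrow> 'a) \<Rightarrow> 'a list \<Rightarrow>
    (('a, nat) tuple \<Rightarrow>\<^sub>0 int) \<Rightarrow> (('a, nat) tuple \<Rightarrow>\<^sub>0 int)" where
  "F_step k f w c = frag_map (tuple_snoc 0 (take (k - 1) w)) c
     + frag_map (tuple_snoc 1 (drop (k - 1) w)) (frag_map (tuple_act f (take (k - 1) w)) c)"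

definition F_full_gen :: "nat \<Rightarrow> ('a \<Rightarrow> 'a list \<Rightarrow> 'a) \<Rightarrow> ('a, 'e) tuple \<Rightarrow> (('a, nat) tuple \<Rightarrow>\<^sub>0 int)" where
  "F_full_gen k f = (\<lambda>(x, vs). fold (\<lambda>(_, w). F_step k f w) vs (frag_of (x, [])))"

definition F_full :: "nat \<Rightarrow> ('a \<Rightarrow> 'a list \<Rightarrow> 'a) \<Rightarrow> (('a, 'e) tuple \<Rightarrow>\<^sub>0 int) \<Rightarrow> (('a, nat) tuple \<Rightarrow>\<^sub>0 int)" where
  "F_full k f = frag_extend (F_full_gen k f)"

lemma F_full_gen_singleton [simp]: "F_full_gen k f (x, []) = frag_of (x, [])"
  by (simp add: F_full_gen_def)

lemma F_full_gen_snoc: "F_full_gen k f (tuple_snoc e w t) = F_step k f w (F_full_gen k f t)"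
  by (simp add: F_full_gen_def tuple_snoc_def split: prod.split)

lemma F_step_0 [simp]: "F_step k f w 0 = 0"
  by (simp add: F_step_def)

lemma F_step_diff: "F_step k f w (a - b) = F_step k f w a - F_step k f w b"
  by (simp add: F_step_def frag_extend_diff)

text \<open>Applied to the summand of the boundary of an extended tuple that keeps the last vector,
  this exposes the image of the smaller boundary to an induction hypothesis.\<close>

lemma F_full_snoc: "F_full k f (frag_map (tuple_snoc e w) c) = F_step k f w (F_full k f c)"
  using subset_UNIV
  by (induction c rule: frag_induction)
    (auto simp: F_full_def F_full_gen_snoc frag_extend_diff F_step_diff)

text \<open>Unfolding the recursion for zero, one and two vectors yields the explicit formulas. The
  bound excludes the longer tuples, on which \<open>F_gen\<close> has its dummy value.\<close>

lemma F_gen_eq_F_full_gen: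
  assumes "length vs \<le> 2"
  shows "F_gen k f (x, vs) = F_full_gen k f (x, vs)"
proof -
  consider "vs = []" | y where "vs = [((), y)]" | y z where "vs = [((), y), ((), z)]"
  proof (cases vs)
    case (Cons p ws)
    with assms that show ?thesis by (cases p; cases ws) auto
  qed
  then show ?thesis
    by cases (simp_all add: F_full_gen_def F_step_def tuple_snoc_def tuple_act_def Let_def
        frag_extend_add)
qed

lemma F_sharp_eq_F_full:
  assumes "Poly_Mapping.keys c \<subseteq> tuples_of_degree X E ar n" and "n \<le> 3"
  shows "F_sharp k f c = F_full k f c"
  unfolding F_sharp_def F_full_def
proof (rule frag_extend_eq)
  fix t
  assume "t \<in> Poly_Mapping.keys c"
  with assms show "F_gen k f t = F_full_gen k f t"
    by (cases t) (auto simp: tuples_of_degree_def intro!: F_gen_eq_F_full_gen)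
qed

locale mutually_distributive_pair =
  fixes X :: "'a set" and k k' :: nat and f g :: "'a \<Rightarrow> 'a list \<Rightarrow> 'a"
  assumes mutually_distributive: "mutually_distributive X k f k' g"
begin

abbreviation "opL \<equiv> \<lambda>e :: nat. if e = 0 then f else g"
abbreviation "arL \<equiv> \<lambda>e :: nat. if e = 0 then k else k'"

sublocale L: distributive_family X "{0, 1}" arL opL
  using mutually_distributive
  by unfold_locales
    (auto simp: mutually_distributive_def distributive_op_def nary_operation_def split: if_splits)

sublocale W: distributive_family X "UNIV :: unit set" "\<lambda>_. k + k' - 1" "\<lambda>_. W_op k f g"
  using distributive_W_op[OF mutually_distributive]
  by unfold_locales (auto simp: distributive_op_def nary_operation_def)

section \<open>One step of the recursion: degree, boundary and action\<close>

lemma vectors_split: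
  assumes "w \<in> vectors X (k + k' - 1 - 1)"
  shows "take (k - 1) w \<in> vectors X (k - 1)" "drop (k - 1) w \<in> vectors X (k' - 1)"
proof -
  have "1 \<le> k" "1 \<le> k'"
    using mutually_distributive
    by (auto simp: mutually_distributive_def distributive_op_def nary_operation_def)
  with assms show "take (k - 1) w \<in> vectors X (k - 1)" "drop (k - 1) w \<in> vectors X (k' - 1)"
    by (auto simp: vectors_def dest: in_set_takeD in_set_dropD)
qed

lemma keys_F_step:
  assumes "w \<in> vectors X (k + k' - 1 - 1)" "Poly_Mapping.keys c \<subseteq> L.tuples n"
  shows "Poly_Mapping.keys (F_step k f w c) \<subseteq> L.tuples (Suc n)"
  unfolding F_step_def
  using L.keys_frag_map_snoc[of 0, OF _ _ assms(2)] vectors_split[OF assms(1)]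
    L.keys_frag_map_snoc[of 1, OF _ _ L.keys_frag_map_act[of 0, OF _ _ assms(2)]]
  by (intro keys_add_subset) auto

lemma keys_F_full_gen: "t \<in> W.tuples n \<Longrightarrow> Poly_Mapping.keys (F_full_gen k f t) \<subseteq> L.tuples n"
proof (induction t arbitrary: n rule: tuple_snoc_induct)
  case (singleton x)
  then show ?case by (auto simp: tuples_of_degree_def)
next
  case (snoc t e w)
  then obtain m where "n = Suc m" "t \<in> W.tuples m" "w \<in> vectors X (k + k' - 1 - 1)"
    by (cases n) (auto simp: tuple_snoc_not_degree_0 tuple_snoc_in_degree_iff)
  with snoc.IH show ?case
    unfolding F_full_gen_snoc by (metis keys_F_step)
qed

text \<open>The two summands of \<open>F_step\<close> contribute \<open>?c' - c\<close> and the
  action of the second half of \<open>w\<close> on \<open>?c'\<close> minus \<open>?c'\<close>, with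
  equal signs; the terms \<open>?c'\<close> cancel.\<close>

lemma boundary_map_F_step:
  assumes w: "w \<in> vectors X (k + k' - 1 - 1)" and c: "Poly_Mapping.keys c \<subseteq> L.tuples n"
  shows "boundary_map opL (F_step k f w c) = F_step k f w (boundary_map opL c)
     + frag_cmul ((- 1) ^ n)
         (frag_map (tuple_act g (drop (k - 1) w)) (frag_map (tuple_act f (take (k - 1) w)) c) - c)"
proof -
  let ?c' = "frag_map (tuple_act f (take (k - 1) w)) c"
  have c': "Poly_Mapping.keys ?c' \<subseteq> L.tuples n"
    using L.keys_frag_map_act[of 0, OF _ _ c] vectors_split[OF w] by simp
  have "boundary_map opL (F_step k f w c) =
      boundary_map opL (frag_map (tuple_snoc 0 (take (k - 1) w)) c)
      + boundary_map opL (frag_map (tuple_snoc 1 (drop (k - 1) w)) ?c')"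
    by (simp add: F_step_def boundary_map_def frag_extend_add)
  also have "\<dots> = frag_map (tuple_snoc 0 (take (k - 1) w)) (boundary_map opL c)
      + frag_cmul ((- 1) ^ n) (?c' - c)
      + (frag_map (tuple_snoc 1 (drop (k - 1) w)) (boundary_map opL ?c')
      + frag_cmul ((- 1) ^ n) (frag_map (tuple_act g (drop (k - 1) w)) ?c' - ?c'))"
    unfolding boundary_map_snoc[OF c] boundary_map_snoc[OF c'] by simp
  also have "boundary_map opL ?c' = frag_map (tuple_act f (take (k - 1) w)) (boundary_map opL c)"
    using L.boundary_map_act[of 0, OF _ _ c] vectors_split[OF w] by simp
  finally show ?thesis
    by (simp add: F_step_def frag_cmul_diff_right)
qed

text \<open>The action of \<open>v\<close> passes through \<open>tuple_snoc\<close> directly and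
  through the action of the first half of \<open>w\<close> by distributivity. Both times that half
  is replaced by its image under \<open>v\<close>, which is the first half of the acted
  \<open>w\<close>.\<close>

lemma F_step_act:
  assumes e: "e \<in> {0, 1}" and v: "v \<in> vectors X (arL e - 1)"
    and w: "w \<in> vectors X (k + k' - 1 - 1)" and c: "Poly_Mapping.keys c \<subseteq> L.tuples n"
  shows "frag_map (tuple_act (opL e) v) (F_step k f w c) =
    F_step k f (vec_act (opL e) w v) (frag_map (tuple_act (opL e) v) c)"
proof -
  have snoc: "frag_map (tuple_act (opL e) v) (frag_map (tuple_snoc d u) b) =
      frag_map (tuple_snoc d (vec_act (opL e) u v)) (frag_map (tuple_act (opL e) v) b)" for d u b
    by (simp only: frag_extend_extend frag_extend_of tuple_act_snoc)
  have act: "frag_map (tuple_act (opL e) v) (frag_map (tuple_act f (take (k - 1) w)) c) =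
      frag_map (tuple_act f (vec_act (opL e) (take (k - 1) w) v)) (frag_map (tuple_act (opL e) v) c)"
    using L.frag_map_act_act[of e 0 "take (k - 1) w" v c n, OF e _ _ v c] vectors_split[OF w] by simp
  have "take (k - 1) (vec_act (opL e) w v) = vec_act (opL e) (take (k - 1) w) v"
    "drop (k - 1) (vec_act (opL e) w v) = vec_act (opL e) (drop (k - 1) w) v"
    by (simp_all add: vec_act_def take_map drop_map)
  then show ?thesis
    by (simp only: F_step_def frag_extend_add snoc act)
qed

text \<open>Acting through \<open>W\<close> means acting with \<open>f\<close> and then with
  \<open>g\<close>, so the induction step applies \<open>F_step_act\<close> once for each
  label.\<close>

lemma F_full_gen_act:
  assumes w: "w \<in> vectors X (k + k' - 1 - 1)"
  shows "t \<in> W.tuples n \<Longrightarrow> F_full_gen k f (tuple_act (W_op k f g) w t) =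
    frag_map (tuple_act g (drop (k - 1) w))
      (frag_map (tuple_act f (take (k - 1) w)) (F_full_gen k f t))"
proof (induction t arbitrary: n rule: tuple_snoc_induct)
  case (singleton x)
  then show ?case by (simp add: tuple_act_def W_op_def)
next
  case (snoc t e u)
  then obtain m where t: "t \<in> W.tuples m" and u: "u \<in> vectors X (k + k' - 1 - 1)"
    by (cases n) (auto simp: tuple_snoc_not_degree_0 tuple_snoc_in_degree_iff)
  let ?c = "F_full_gen k f t" and ?w0 = "take (k - 1) w" and ?w1 = "drop (k - 1) w"
  \<comment> \<open>The second use of \<open>F_step_act\<close> concerns \<open>u\<close> already
    acted on by \<open>?w0\<close>, which must still be an argument of \<open>W\<close>.\<close>
  have u0: "vec_act f u ?w0 \<in> vectors X (k + k' - 1 - 1)"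
    using L.vec_act_closed[of 0 ?w0 u] vectors_split[OF w] u by simp
  have c: "Poly_Mapping.keys ?c \<subseteq> L.tuples m"
    by (rule keys_F_full_gen[OF t])
  then have c0: "Poly_Mapping.keys (frag_map (tuple_act f ?w0) ?c) \<subseteq> L.tuples m"
    using L.keys_frag_map_act[of 0 ?w0 ?c m] vectors_split[OF w] by simp
  have "frag_map (tuple_act g ?w1) (frag_map (tuple_act f ?w0) (F_step k f u ?c)) =
      F_step k f (vec_act g (vec_act f u ?w0) ?w1)
        (frag_map (tuple_act g ?w1) (frag_map (tuple_act f ?w0) ?c))"
    using F_step_act[of 0 ?w0, OF _ _ u c] F_step_act[of 1 ?w1, OF _ _ u0 c0] vectors_split[OF w]
    by simp
  moreover have "vec_act (W_op k f g) u w = vec_act g (vec_act f u ?w0) ?w1"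
    by (simp add: vec_act_def W_op_def)
  ultimately show ?case
    by (simp add: tuple_act_snoc F_full_gen_snoc snoc.IH[OF t])
qed

text \<open>The induction hypothesis handles the faces that keep \<open>w\<close>; by
  \<open>F_full_gen_act\<close> the remainder in \<open>boundary_map_F_step\<close> is the image of
  the last pair of faces for \<open>W\<close>.\<close>

lemma boundary_map_F_full_gen:
  "t \<in> W.tuples n \<Longrightarrow>
     boundary_map opL (F_full_gen k f t) = F_full k f (boundary_gen (\<lambda>_. W_op k f g) t)"
proof (induction t arbitrary: n rule: tuple_snoc_induct)
  case (singleton x)
  then show ?case by (simp add: boundary_map_def F_full_def)
next
  case (snoc t e w)
  then obtain m where t: "t \<in> W.tuples m" and w: "w \<in> vectors X (k + k' - 1 - 1)"
    by (cases n) (auto simp: tuple_snoc_not_degree_0 tuple_snoc_in_degree_iff)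
  then have "Suc (length (snd t)) = m"
    by (auto simp: tuples_of_degree_def)
  then show ?case
    unfolding F_full_gen_snoc boundary_map_F_step[OF w keys_F_full_gen[OF t]] snoc.IH[OF t]
      boundary_gen_snoc
    by (simp add: F_full_def frag_extend_add frag_extend_cmul frag_extend_diff F_full_gen_act[OF w t]
        flip: F_full_snoc[unfolded F_full_def])
qed

section \<open>From generators to the chain groups\<close>

lemma F_full_hom: "F_full k f \<in> hom (C_W X k k' n) (C_L X k k' n)"
  unfolding F_full_def C_W_def C_L_def chain_group_def
  by (rule frag_extend_hom) (use keys_F_full_gen in simp)

lemma boundary_F_full:
  assumes "c \<in> carrier (C_W X k k' n)"
  shows "d_L f g (F_full k f c) = F_full k f (d_W k f g c)"
  using assms boundary_map_F_full_gen[of _ n]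
  unfolding d_L_def d_W_def C_W_def chain_group_def F_full_def
  by (auto simp: boundary_map_def frag_extend_extend intro!: frag_extend_eq)

lemma d_W_hom: "d_W k f g \<in> hom (C_W X k k' n) (C_W X k k' (n - 1))"
  unfolding d_W_def C_W_def by (rule W.boundary_map_hom)

lemma d_L_hom: "d_L f g \<in> hom (C_L X k k' n) (C_L X k k' (n - 1))"
  unfolding d_L_def C_L_def by (rule L.boundary_map_hom)

end


section \<open>Maps induced on quotients and on homology\<close>

definition coset_map :: "('d, 'n) monoid_scheme \<Rightarrow> 'd set \<Rightarrow> ('c \<Rightarrow> 'd) \<Rightarrow> 'c set \<Rightarrow> 'd set" where
  "coset_map H M h T = the_elem ((\<lambda>t. M #>\<^bsub>H\<^esub> h t) ` T)"

text \<open>Changing the representative by \<open>y\<close> in \<open>N\<close> changes its image by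
  \<open>h y\<close> in \<open>M\<close>, which the coset absorbs; so \<open>the_elem\<close> is
  applied to a singleton.\<close>

lemma coset_map_coset:
  assumes "group G" "group H" "h \<in> hom G H" "subgroup N G" "subgroup M H" "h ` N \<subseteq> M"
    and x: "x \<in> carrier G"
  shows "coset_map H M h (N #>\<^bsub>G\<^esub> x) = M #>\<^bsub>H\<^esub> h x"
proof -
  interpret group_hom G H h
    using assms(1-3) by (simp add: group_hom_def group_hom_axioms_def)
  have "M #>\<^bsub>H\<^esub> h (y \<otimes>\<^bsub>G\<^esub> x) = M #>\<^bsub>H\<^esub> h x" if "y \<in> N" for y
  proof -
    have "h y \<in> M" "y \<in> carrier G"
      using that assms(4,6) by (auto dest: subgroup.mem_carrier)
    then show ?thesis
      using x H.coset_mult_assoc[OF subgroup.subset[OF assms(5)], of "h y" "h x"]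
        H.coset_join2[OF _ assms(5)] by simp
  qed
  moreover have "N \<noteq> {}"
    using subgroup.one_closed[OF assms(4)] by auto
  ultimately have "(\<lambda>t. M #>\<^bsub>H\<^esub> h t) ` (N #>\<^bsub>G\<^esub> x) = {M #>\<^bsub>H\<^esub> h x}"
    by (auto simp: r_coset_def[of G])
  then show ?thesis
    by (simp add: coset_map_def)
qed

lemma carrier_Mod_restrict:
  "carrier (G\<lparr>carrier := Z\<rparr> Mod N) = (\<lambda>z. N #>\<^bsub>G\<^esub> z) ` Z"
  by (auto simp: carrier_FactGroup r_coset_def)

lemma set_mult_restrict [simp]: "S <#>\<^bsub>G\<lparr>carrier := Z\<rparr>\<^esub> T = S <#>\<^bsub>G\<^esub> T"
  by (simp add: set_mult_def)

text \<open>Homology is a quotient of a set of cycles \<open>Z\<close> inside a chain group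
  \<open>G\<close>. Its cosets and their products are those of \<open>G\<close>, so the computation
  takes place there; commutativity makes \<open>N\<close> and \<open>M\<close> normal.\<close>

lemma coset_map_hom:
  assumes "comm_group G" "comm_group H" "h \<in> hom G H" "subgroup N G" "subgroup M H" "h ` N \<subseteq> M"
    and Z: "Z \<subseteq> carrier G" "h ` Z \<subseteq> Z'"
  shows "coset_map H M h \<in> hom (G\<lparr>carrier := Z\<rparr> Mod N) (H\<lparr>carrier := Z'\<rparr> Mod M)"
proof -
  interpret G: comm_group G by fact
  interpret H: comm_group H by fact
  interpret N: normal N G
    using assms(4) by (simp add: G.normal_iff_subgroup)
  interpret M: normal M H
    using assms(5) by (simp add: H.normal_iff_subgroup)
  note coset = coset_map_coset[OF G.group_axioms H.group_axioms assms(3-6)]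
  show ?thesis
  proof (rule homI)
    fix S T
    assume "S \<in> carrier (G\<lparr>carrier := Z\<rparr> Mod N)" "T \<in> carrier (G\<lparr>carrier := Z\<rparr> Mod N)"
    then obtain x y where xy: "x \<in> carrier G" "y \<in> carrier G" "S = N #>\<^bsub>G\<^esub> x" "T = N #>\<^bsub>G\<^esub> y"
      using Z unfolding carrier_Mod_restrict by blast
    then have "h x \<in> carrier H" "h y \<in> carrier H"
      using assms(3) by (auto dest: hom_in_carrier)
    with xy show "coset_map H M h (S \<otimes>\<^bsub>G\<lparr>carrier := Z\<rparr> Mod N\<^esub> T) =
        coset_map H M h S \<otimes>\<^bsub>H\<lparr>carrier := Z'\<rparr> Mod M\<^esub> coset_map H M h T"
      by (simp add: N.rcos_sum M.rcos_sum coset hom_mult[OF assms(3)])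
  next
    fix S
    assume "S \<in> carrier (G\<lparr>carrier := Z\<rparr> Mod N)"
    then obtain x where "x \<in> Z" "S = N #>\<^bsub>G\<^esub> x"
      unfolding carrier_Mod_restrict by blast
    with Z coset show "coset_map H M h S \<in> carrier (H\<lparr>carrier := Z'\<rparr> Mod M)"
      unfolding carrier_Mod_restrict by blast
  qed
qed

lemma subgroup_image:
  assumes "group G" "group H" "h \<in> hom G H"
  shows "subgroup (h ` carrier G) H"
proof -
  interpret group_hom G H h
    using assms by (simp add: group_hom_def group_hom_axioms_def)
  show ?thesis
    by (rule img_is_subgroup)
qed

lemma induced_homology_map:
  assumes C: "\<And>m. comm_group (C m)" and D: "\<And>m. comm_group (D m)"
    and dC: "\<And>m. dC m \<in> hom (C m) (C (m - 1))" and dD: "\<And>m. dD m \<in> hom (D m) (D (m - 1))"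
    and h: "\<And>m. h m \<in> hom (C m) (D m)"
    and comm: "\<And>m c. c \<in> carrier (C m) \<Longrightarrow> dD m (h m c) = h (m - 1) (dC m c)"
  shows "\<exists>H\<in>hom (homology C dC n) (homology D dD n).
    \<forall>z\<in>cycles C dC n. H (homology_class C dC n z) = homology_class D dD n (h n z)"
proof
  have grp: "group (C m)" "group (D m)" for m
    using C D by (simp_all add: comm_group_def)
  have sub: "subgroup (boundaries C dC n) (C n)" "subgroup (boundaries D dD n) (D n)"
    using subgroup_image[OF grp(1,1) dC, of "n + 1"] subgroup_image[OF grp(2,2) dD, of "n + 1"]
    by (simp_all add: boundaries_def)
  \<comment> \<open>Boundaries come from degree \<open>n + 1\<close>, so the commuting square one
    degree higher is what matters here.\<close>
  have bound: "h n ` boundaries C dC n \<subseteq> boundaries D dD n"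
    using hom_in_carrier[OF h] by (auto simp: boundaries_def comm[of _ "n + 1", simplified, symmetric])
  \<comment> \<open>Cycles are the elements sent to the unit, and \<open>h (n - 1)\<close> preserves
    the unit.\<close>
  have "h (n - 1) \<one>\<^bsub>C (n - 1)\<^esub> = \<one>\<^bsub>D (n - 1)\<^esub>"
    by (rule hom_one[OF h grp])
  then have cyc: "h n ` cycles C dC n \<subseteq> cycles D dD n"
    using hom_in_carrier[OF h] by (auto simp: cycles_def kernel_def comm)
  have carr: "cycles C dC n \<subseteq> carrier (C n)"
    by (auto simp: cycles_def kernel_def)
  show "coset_map (D n) (boundaries D dD n) (h n) \<in> hom (homology C dC n) (homology D dD n)"
    unfolding homology_def by (rule coset_map_hom[OF C D h sub bound carr cyc])
  show "\<forall>z\<in>cycles C dC n. coset_map (D n) (boundaries D dD n) (h n) (homology_class C dC n z) =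
      homology_class D dD n (h n z)"
    using coset_map_coset[OF grp h sub bound] carr by (auto simp: homology_class_def)
qed

lemma induced_cohomology_map:
  assumes C: "\<And>m. comm_group (C m)" and D: "\<And>m. comm_group (D m)"
    and dC: "\<And>m. dC m \<in> hom (C m) (C (m + 1))" and dD: "\<And>m. dD m \<in> hom (D m) (D (m + 1))"
    and h: "\<And>m. h m \<in> hom (C m) (D m)"
    and comm: "\<And>m c. c \<in> carrier (C m) \<Longrightarrow> dD m (h m c) = h (m + 1) (dC m c)"
    and n: "1 \<le> n"
  shows "\<exists>H\<in>hom (cohomology C dC n) (cohomology D dD n).
    \<forall>z\<in>cocycles C dC n. H (cohomology_class C dC n z) = cohomology_class D dD n (h n z)"
proof
  have grp: "group (C m)" "group (D m)" for m
    using C D by (simp_all add: comm_group_def)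
  have sub: "subgroup (coboundaries C dC n) (C n)" "subgroup (coboundaries D dD n) (D n)"
    using subgroup_image[OF grp(1,1) dC, of "n - 1"] subgroup_image[OF grp(2,2) dD, of "n - 1"] n
    by (simp_all add: coboundaries_def)
  \<comment> \<open>This is the square in degree \<open>n - 1\<close>; \<open>1 \<le> n\<close>
    ensures that it ends in degree \<open>n\<close>.\<close>
  have bound: "h n ` coboundaries C dC n \<subseteq> coboundaries D dD n"
    using hom_in_carrier[OF h] comm[of _ "n - 1", symmetric] n by (auto simp: coboundaries_def)
  have "h (n + 1) \<one>\<^bsub>C (n + 1)\<^esub> = \<one>\<^bsub>D (n + 1)\<^esub>"
    by (rule hom_one[OF h grp])
  then have cyc: "h n ` cocycles C dC n \<subseteq> cocycles D dD n"
    using hom_in_carrier[OF h] by (auto simp: cocycles_def kernel_def comm)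
  have carr: "cocycles C dC n \<subseteq> carrier (C n)"
    by (auto simp: cocycles_def kernel_def)
  show "coset_map (D n) (coboundaries D dD n) (h n) \<in> hom (cohomology C dC n) (cohomology D dD n)"
    unfolding cohomology_def by (rule coset_map_hom[OF C D h sub bound carr cyc])
  show "\<forall>z\<in>cocycles C dC n. coset_map (D n) (coboundaries D dD n) (h n) (cohomology_class C dC n z) =
      cohomology_class D dD n (h n z)"
    using coset_map_coset[OF grp h sub bound] carr by (auto simp: cohomology_class_def)
qed


section \<open>Functoriality of the tensor product\<close>

lemma comm_group_pairs_group: "comm_group (pairs_group C A)"
  by (simp add: pairs_group_def abelian_free_Abelian_group)

lemma bilinear_relations_carrier:
  assumes "group C" "group A"
  shows "bilinear_relations C A \<subseteq> carrier (pairs_group C A)"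
proof -
  interpret C: group C by fact
  interpret A: group A by fact
  have "frag_of p - frag_of q - frag_of r \<in> carrier (pairs_group C A)"
    if "p \<in> carrier C \<times> carrier A" "q \<in> carrier C \<times> carrier A" "r \<in> carrier C \<times> carrier A" for p q r
    using that keys_diff[of "frag_of p - frag_of q" "frag_of r"] keys_diff[of "frag_of p" "frag_of q"]
    unfolding pairs_group_def by fastforce
  then show ?thesis
    unfolding bilinear_relations_def by auto
qed

lemma subgroup_bilinear_subgroup:
  assumes "group C" "group A"
  shows "subgroup (bilinear_subgroup C A) (pairs_group C A)"
  unfolding bilinear_subgroup_def
  using comm_group_pairs_group[of C A] bilinear_relations_carrier[OF assms]
  by (simp add: comm_group_def group.generate_is_subgroup)

lemma comm_group_tensor: "group C \<Longrightarrow> group A \<Longrightarrow> comm_group (tensor C A)"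
  unfolding tensor_def
  by (intro comm_group.abelian_FactGroup comm_group_pairs_group subgroup_bilinear_subgroup)

definition pairs_map :: "('c \<Rightarrow> 'd) \<Rightarrow> ('c \<times> 'b \<Rightarrow>\<^sub>0 int) \<Rightarrow> ('d \<times> 'b \<Rightarrow>\<^sub>0 int)" where
  "pairs_map h = frag_extend (\<lambda>(c, a). frag_of (h c, a))"

lemma pairs_map_hom:
  assumes "h \<in> hom C D"
  shows "pairs_map h \<in> hom (pairs_group C A) (pairs_group D A)"
  unfolding pairs_map_def pairs_group_def
  by (rule frag_extend_hom) (use hom_in_carrier[OF assms] in auto)

text \<open>A homomorphism \<open>h\<close> sends each bilinearity relation to a bilinearity
  relation, and the image of a generated subgroup is generated by the image of its
  generators.\<close>

lemma pairs_map_bilinear_subgroup: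
  assumes "group C" "group A" "h \<in> hom C D"
  shows "pairs_map h ` bilinear_subgroup C A \<subseteq> bilinear_subgroup D A"
proof -
  interpret P: group_hom "pairs_group C A" "pairs_group D A" "pairs_map h"
    using comm_group_pairs_group[of C A] comm_group_pairs_group[of D A] pairs_map_hom[OF assms(3)]
    by (simp add: comm_group_def group_hom_def group_hom_axioms_def)
  have "pairs_map h ` bilinear_relations C A \<subseteq> bilinear_relations D A"
    using hom_in_carrier[OF assms(3)]
    by (fastforce simp: bilinear_relations_def pairs_map_def frag_extend_diff hom_mult[OF assms(3)])
  then show ?thesis
    unfolding bilinear_subgroup_def P.generate_img[OF bilinear_relations_carrier[OF assms(1,2)], symmetric]
    by (rule P.H.mono_generate)
qed

lemma tensor_map_eq_coset_map:
  "tensor_map D A h = coset_map (pairs_group D A) (bilinear_subgroup D A) (pairs_map h)"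
  by (simp add: fun_eq_iff tensor_map_def coset_map_def pairs_map_def)

lemma tensor_map_coset:
  assumes "group C" "group D" "group A" "h \<in> hom C D" "t \<in> carrier (pairs_group C A)"
  shows "tensor_map D A h (bilinear_subgroup C A #>\<^bsub>pairs_group C A\<^esub> t) =
    bilinear_subgroup D A #>\<^bsub>pairs_group D A\<^esub> pairs_map h t"
  unfolding tensor_map_eq_coset_map using assms
  by (intro coset_map_coset pairs_map_hom subgroup_bilinear_subgroup pairs_map_bilinear_subgroup
      comm_group.axioms(2)[OF comm_group_pairs_group])

lemma tensor_map_hom:
  assumes "group C" "group D" "group A" "h \<in> hom C D"
  shows "tensor_map D A h \<in> hom (tensor C A) (tensor D A)"
proof -
  \<comment> \<open>The whole carrier is taken as \<open>Z\<close> in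
    \<open>coset_map_hom\<close>.\<close>
  have "tensor_map D A h \<in>
      hom ((pairs_group C A)\<lparr>carrier := carrier (pairs_group C A)\<rparr> Mod bilinear_subgroup C A)
        ((pairs_group D A)\<lparr>carrier := carrier (pairs_group D A)\<rparr> Mod bilinear_subgroup D A)"
    unfolding tensor_map_eq_coset_map
    using assms hom_carrier[OF pairs_map_hom[OF assms(4)]]
    by (intro coset_map_hom pairs_map_hom subgroup_bilinear_subgroup pairs_map_bilinear_subgroup
        comm_group_pairs_group) auto
  then show ?thesis
    by (simp add: tensor_def)
qed

lemma carrier_tensor:
  "carrier (tensor C A) =
     (\<lambda>t. bilinear_subgroup C A #>\<^bsub>pairs_group C A\<^esub> t) ` carrier (pairs_group C A)"
  by (simp add: tensor_def carrier_FactGroup)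

text \<open>A representative involves only pairs whose first component lies in \<open>C\<close>, so
  only the values of \<open>h\<close> there enter.\<close>

lemma tensor_map_cong:
  assumes "group C" "group D" "group A" "h \<in> hom C D" "h' \<in> hom C D"
    and "\<And>c. c \<in> carrier C \<Longrightarrow> h c = h' c" and "T \<in> carrier (tensor C A)"
  shows "tensor_map D A h T = tensor_map D A h' T"
proof -
  obtain t where t: "t \<in> carrier (pairs_group C A)" "T = bilinear_subgroup C A #>\<^bsub>pairs_group C A\<^esub> t"
    using assms(7) by (auto simp: carrier_tensor)
  moreover have "pairs_map h t = pairs_map h' t"
    using t(1) assms(6) unfolding pairs_map_def pairs_group_def by (auto intro!: frag_extend_eq)
  ultimately show ?thesis
    using assms by (simp add: tensor_map_coset)
qed

lemma tensor_map_comp: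
  assumes "group C" "group D" "group D'" "group A" "h \<in> hom C D" "h' \<in> hom D D'"
    and "T \<in> carrier (tensor C A)"
  shows "tensor_map D' A h' (tensor_map D A h T) = tensor_map D' A (h' \<circ> h) T"
proof -
  obtain t where t: "t \<in> carrier (pairs_group C A)" "T = bilinear_subgroup C A #>\<^bsub>pairs_group C A\<^esub> t"
    using assms(7) by (auto simp: carrier_tensor)
  moreover have "pairs_map h' (pairs_map h t) = pairs_map (h' \<circ> h) t"
    by (simp add: pairs_map_def frag_extend_extend case_prod_unfold)
  ultimately show ?thesis
    using assms hom_in_carrier[OF pairs_map_hom[OF assms(5)] t(1)] hom_compose[OF assms(5,6)]
    by (simp add: tensor_map_coset)
qed


section \<open>Functoriality of the group of homomorphisms\<close>

lemma carrier_Hom_group: "carrier (Hom_group C A) = hom C A \<inter> extensional (carrier C)"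
  by (simp add: Hom_group_def)

lemma mult_Hom_group:
  "\<phi> \<otimes>\<^bsub>Hom_group C A\<^esub> \<psi> = (\<lambda>c\<in>carrier C. \<phi> c \<otimes>\<^bsub>A\<^esub> \<psi> c)"
  by (simp add: Hom_group_def)

lemma one_Hom_group: "\<one>\<^bsub>Hom_group C A\<^esub> = (\<lambda>c\<in>carrier C. \<one>\<^bsub>A\<^esub>)"
  by (simp add: Hom_group_def)

lemma comm_group_Hom_group:
  assumes "group C" "comm_group A"
  shows "comm_group (Hom_group C A)"
proof -
  interpret C: group C by fact
  interpret A: comm_group A by fact
  note defs = carrier_Hom_group mult_Hom_group one_Hom_group
  show ?thesis
  proof (rule comm_groupI)
    fix \<phi> \<psi>
    assume "\<phi> \<in> carrier (Hom_group C A)" "\<psi> \<in> carrier (Hom_group C A)"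
    \<comment> \<open>The pointwise product of homomorphisms is a homomorphism because
      \<open>A\<close> is commutative.\<close>
    then show "\<phi> \<otimes>\<^bsub>Hom_group C A\<^esub> \<psi> \<in> carrier (Hom_group C A)"
      by (auto simp: defs hom_def Pi_iff A.m_ac)
    show "\<phi> \<otimes>\<^bsub>Hom_group C A\<^esub> \<psi> = \<psi> \<otimes>\<^bsub>Hom_group C A\<^esub> \<phi>"
      using \<open>\<phi> \<in> _\<close> \<open>\<psi> \<in> _\<close> by (auto simp: defs hom_def Pi_iff A.m_ac restrict_def fun_eq_iff)
  next
    show "\<one>\<^bsub>Hom_group C A\<^esub> \<in> carrier (Hom_group C A)"
      by (auto simp: defs hom_def)
  next
    fix \<phi> \<psi> \<chi>
    assume "\<phi> \<in> carrier (Hom_group C A)" "\<psi> \<in> carrier (Hom_group C A)" "\<chi> \<in> carrier (Hom_group C A)"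
    then show "\<phi> \<otimes>\<^bsub>Hom_group C A\<^esub> \<psi> \<otimes>\<^bsub>Hom_group C A\<^esub> \<chi> =
        \<phi> \<otimes>\<^bsub>Hom_group C A\<^esub> (\<psi> \<otimes>\<^bsub>Hom_group C A\<^esub> \<chi>)"
      by (auto simp: defs hom_def Pi_iff A.m_assoc restrict_def fun_eq_iff)
  next
    fix \<phi>
    assume \<phi>: "\<phi> \<in> carrier (Hom_group C A)"
    \<comment> \<open>Outside the carrier of \<open>C\<close> the two sides agree because
      \<open>\<phi>\<close> is extensional.\<close>
    then show "\<one>\<^bsub>Hom_group C A\<^esub> \<otimes>\<^bsub>Hom_group C A\<^esub> \<phi> = \<phi>"
      by (auto simp: defs hom_def Pi_iff restrict_def fun_eq_iff extensional_def)
    show "\<exists>\<psi>\<in>carrier (Hom_group C A). \<psi> \<otimes>\<^bsub>Hom_group C A\<^esub> \<phi> = \<one>\<^bsub>Hom_group C A\<^esub>"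
    proof
      show "(\<lambda>c\<in>carrier C. inv\<^bsub>A\<^esub> \<phi> c) \<in> carrier (Hom_group C A)"
        using \<phi> by (auto simp: defs hom_def Pi_iff A.inv_mult)
      show "(\<lambda>c\<in>carrier C. inv\<^bsub>A\<^esub> \<phi> c) \<otimes>\<^bsub>Hom_group C A\<^esub> \<phi> = \<one>\<^bsub>Hom_group C A\<^esub>"
        using \<phi> by (auto simp: defs hom_def Pi_iff restrict_def fun_eq_iff)
    qed
  qed
qed

lemma dual_map_hom:
  assumes "group C" "h \<in> hom C D"
  shows "dual_map C h \<in> hom (Hom_group D A) (Hom_group C A)"
proof -
  interpret C: group C by fact
  show ?thesis
    using assms(2)
    by (intro homI) (auto simp: carrier_Hom_group mult_Hom_group dual_map_def compose_def hom_def
        Pi_iff fun_eq_iff)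
qed


section \<open>The chain map in low degrees and its induced maps\<close>

theorem theorem5p3:
  fixes X :: "'a set" and k k' :: nat
    and op0 op1 :: "'a \<Rightarrow> 'a list \<Rightarrow> 'a"
    and A :: "('b, 'm) monoid_scheme"
  assumes "mutually_distributive X k op0 k' op1"
    and "comm_group A"
  defines "F \<equiv> F_sharp k op0"
    and "CW \<equiv> C_W X k k'" and "dW \<equiv> d_W k op0 op1"
    and "CL \<equiv> C_L X k k'" and "dL \<equiv> d_L op0 op1"
  defines "CWA \<equiv> tensor_complex CW A" and "dWA \<equiv> tensor_differential CW dW A"
    and "CLA \<equiv> tensor_complex CL A" and "dLA \<equiv> tensor_differential CL dL A"
    and "HomW \<equiv> Hom_complex CW A" and "deltaW \<equiv> Hom_differential CW dW"
    and "HomL \<equiv> Hom_complex CL A" and "deltaL \<equiv> Hom_differential CL dL"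
  shows "(\<forall>n\<in>{1, 2, 3}. F \<in> hom (CW n) (CL n)) \<and>
    (\<forall>n\<in>{2, 3}. \<forall>c\<in>carrier (CW n). dL (F c) = F (dW c)) \<and>
    (\<forall>n\<in>{2, 3}. \<exists>h\<in>hom (homology CWA dWA n) (homology CLA dLA n).
       \<forall>z\<in>cycles CWA dWA n.
         h (homology_class CWA dWA n z) = homology_class CLA dLA n (tensor_map (CL n) A F z)) \<and>
    (\<forall>n\<in>{2, 3}. \<exists>h\<in>hom (cohomology HomL deltaL n) (cohomology HomW deltaW n).
       \<forall>\<phi>\<in>cocycles HomL deltaL n.
         h (cohomology_class HomL deltaL n \<phi>) = cohomology_class HomW deltaW n (dual_map (CW n) F \<phi>))"
proof -
  interpret mutually_distributive_pair X k k' op0 op1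
    using assms(1) by unfold_locales
  \<comment> \<open>\<open>G\<close> satisfies the chain map equation in every degree, and agrees
    with \<open>F\<close> up to degree 3. Statements about \<open>F\<close> are obtained from those
    about \<open>G\<close>.\<close>
  define G :: "(('a, unit) tuple \<Rightarrow>\<^sub>0 int) \<Rightarrow> _" where "G = F_full k op0"
  have F_eq_G: "F c = G c" if "c \<in> carrier (CW n)" "n \<le> 3" for c n
    using that F_sharp_eq_F_full[of c X UNIV "\<lambda>_. k + k' - 1" n k op0]
    by (simp add: F_def G_def CW_def C_W_def chain_group_def)
  have grp: "group (CW n)" "group (CL n)" for n
    by (simp_all add: CW_def CL_def C_W_def C_L_def chain_group_def)
  have A: "group A"
    using assms(2) by (simp add: comm_group_def)
  have G_hom: "G \<in> hom (CW n) (CL n)" for n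
    unfolding G_def CW_def CL_def by (rule F_full_hom)
  have dW_hom: "dW \<in> hom (CW n) (CW (n - 1))" for n
    unfolding dW_def CW_def by (rule d_W_hom)
  have dL_hom: "dL \<in> hom (CL n) (CL (n - 1))" for n
    unfolding dL_def CL_def by (rule d_L_hom)
  have dG: "dL (G c) = G (dW c)" if "c \<in> carrier (CW n)" for c n
    using boundary_F_full that by (simp add: G_def dL_def dW_def CW_def)
  have F_hom: "F \<in> hom (CW n) (CL n)" if "n \<le> 3" for n
    by (rule group.hom_restrict[OF grp(1) G_hom]) (simp add: F_eq_G[OF _ that])
  \<comment> \<open>Both \<open>c\<close> and \<open>dW c\<close> have degree at most 3, so
    \<open>F\<close> may be exchanged for \<open>G\<close> on either side.\<close>
  have dF: "dL (F c) = F (dW c)" if "n \<le> 3" "c \<in> carrier (CW n)" for c n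
    using F_eq_G[OF that(2,1)] F_eq_G[OF hom_in_carrier[OF dW_hom that(2)]] that dG by simp
  have homology: "\<exists>h\<in>hom (homology CWA dWA n) (homology CLA dLA n). \<forall>z\<in>cycles CWA dWA n.
      h (homology_class CWA dWA n z) = homology_class CLA dLA n (tensor_map (CL n) A F z)"
    if n: "n \<le> 3" for n
  proof -
    \<comment> \<open>\<open>G\<close> is used because the induced map needs commuting squares in
      all degrees, in particular in degree 4 for \<open>n = 3\<close>.\<close>
    have "\<exists>h\<in>hom (homology CWA dWA n) (homology CLA dLA n). \<forall>z\<in>cycles CWA dWA n.
      h (homology_class CWA dWA n z) = homology_class CLA dLA n (tensor_map (CL n) A G z)"
    proof (rule induced_homology_map[where h = "\<lambda>n. tensor_map (CL n) A G"])
      fix m T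
      assume "T \<in> carrier (CWA m)"
      then have T: "T \<in> carrier (tensor (CW m) A)"
        by (simp add: CWA_def tensor_complex_def)
      \<comment> \<open>Functoriality reduces the tensored square to the equality of two composites
        on chains of degree \<open>m\<close>.\<close>
      have "tensor_map (CL (m - 1)) A (dL \<circ> G) T = tensor_map (CL (m - 1)) A (G \<circ> dW) T"
        using dG hom_compose[OF G_hom dL_hom] hom_compose[OF dW_hom G_hom]
        by (intro tensor_map_cong[OF grp A _ _ _ T]) auto
      then show "dLA m (tensor_map (CL m) A G T) = tensor_map (CL (m - 1)) A G (dWA m T)"
        unfolding dLA_def dWA_def tensor_differential_def
        by (simp only: tensor_map_comp[OF grp(1,2,2) A G_hom dL_hom T]
            tensor_map_comp[OF grp(1,1,2) A dW_hom G_hom T])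
    qed (auto simp: CWA_def CLA_def dWA_def dLA_def tensor_complex_def tensor_differential_def
        simp del: One_nat_def intro!: comm_group_tensor tensor_map_hom grp A G_hom dW_hom dL_hom)
    moreover have "tensor_map (CL n) A F z = tensor_map (CL n) A G z" if "z \<in> cycles CWA dWA n" for z
      using that F_eq_G n
      by (intro tensor_map_cong[OF grp A F_hom G_hom])
        (auto simp: cycles_def kernel_def CWA_def tensor_complex_def)
    ultimately show ?thesis by simp
  qed
  have cohomology: "\<exists>h\<in>hom (cohomology HomL deltaL n) (cohomology HomW deltaW n).
      \<forall>\<phi>\<in>cocycles HomL deltaL n.
        h (cohomology_class HomL deltaL n \<phi>) = cohomology_class HomW deltaW n (dual_map (CW n) F \<phi>)"
    if n: "1 \<le> n" "n \<le> 3" for n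
  proof -
    \<comment> \<open>A dual map in degree \<open>n\<close> evaluates its map only on chains of
      degree \<open>n\<close>, where \<open>F\<close> and \<open>G\<close> coincide.\<close>
    have dual_eq: "dual_map (CW n) F = (dual_map (CW n) G :: (_ \<Rightarrow> 'b) \<Rightarrow> _)"
      using F_eq_G n by (auto simp: dual_map_def compose_def fun_eq_iff)
    show ?thesis
      unfolding dual_eq
    proof (rule induced_cohomology_map[where h = "\<lambda>n. dual_map (CW n) G"])
      \<comment> \<open>On a chain \<open>c\<close> the sides are \<open>\<phi>\<close> at
        \<open>G (dW c)\<close> and at \<open>dL (G c)\<close>; off the carrier both are
        undefined.\<close>
      show "deltaW m (dual_map (CW m) G \<phi>) = dual_map (CW (m + 1)) G (deltaL m \<phi>)" for m \<phi>
        using hom_in_carrier[OF dW_hom[of "m + 1"]] hom_in_carrier[OF G_hom[of "m + 1"]] dG[of _ "m + 1"]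
        by (auto simp: deltaW_def deltaL_def Hom_differential_def dual_map_def compose_def fun_eq_iff)
      show "deltaW m \<in> hom (HomW m) (HomW (m + 1))" "deltaL m \<in> hom (HomL m) (HomL (m + 1))" for m
        using dW_hom[of "m + 1"] dL_hom[of "m + 1"]
        by (simp_all add: deltaW_def deltaL_def HomW_def HomL_def Hom_differential_def Hom_complex_def
            dual_map_hom grp)
      show "comm_group (HomW m)" "comm_group (HomL m)" for m
        by (simp_all add: HomW_def HomL_def Hom_complex_def comm_group_Hom_group grp assms(2))
      show "dual_map (CW m) G \<in> hom (HomL m) (HomW m)" for m
        by (simp add: HomW_def HomL_def Hom_complex_def dual_map_hom grp G_hom)
    qed (fact n)
  qed
  from F_hom dF[of 2] dF[of 3] homology cohomology show ?thesis by auto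
qed

end
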